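(* If $I\subset E=\{m+ni:(m,n)\in\mathbb N\times\mathbb Z\}$ is porous in $E$ (i.e. $\overline{J_I}$ is porous in $\mathbb C$), then its upper box dimension satisfies $\overline{\mathrm{BD}}(I)<2$, where $$\overline{\mathrm{BD}}(I)=\limsup_{R\to+\infty}\ \sup\left\{\frac{\log\sharp(I\cap Q)}{\log R}: Q\in\Delta(R)\right\}.$$
   Context: $\mathbb N=\{1,2,\dots\}$; $E$ is viewed as a subset of $\mathbb Z^2$. $\Delta(R)$ is the collection of all closed filled squares in $\mathbb C$ with sides parallel to the axes and side length $R$ (with arbitrary center in $\mathbb C$). Let $X=\overline B(1/2,1/2)\subset\mathbb C$ and $\phi_e:X\to X$, $\phi_e(z)=1/(e+z)$, for $e\in E$. For $\omega\in I^{\mathbb N}$, $\pi(\omega)$ is the unique point of $\bigcap_n\phi_{\omega_1}\circ\cdots\circ\phi_{\omega_n}(X)$, and $J_I=\pi(I^{\mathbb N})$ is the limit set of the complex continued fractions system $\{\phi_e\}_{e\in I}$; $\overline{J_I}$ is its closure in $\mathbb C$. Porosity (in $\mathbb C$, Euclidean metric): for a bounded $G\subset\mathbb C$, $x\in\mathbb C$, $r>0$, $\operatorname{por}(G,x,r)=\sup\{c\ge0: B(y,cr)\subset B(x,r)\setminus G\text{ for some }y\in\mathbb C\}$. $G$ is porous if there are $c\in(0,1)$, $r_0>0$ with $\operatorname{por}(G,x,r)\ge c$ for all $x\in G$ and $r\in(0,r_0)$. *)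

theory Defs
  imports "HOL-Analysis.Analysis"
begin

definition alphabet :: "complex set" where
  "alphabet = {of_nat m + of_int n * \<i> |(m::nat) (n::int). m \<ge> 1}"

definition cf_space :: "complex set" where
  "cf_space = cball (1/2) (1/2)"

definition cf_map :: "complex \<Rightarrow> complex \<Rightarrow> complex" where
  "cf_map e z = 1 / (e + z)"

(* Infinite words are indexed from 0, so cf_word w n is the composition of the maps
   of the first n letters w 0, ..., w (n - 1), the first letter being outermost. *)
primrec cf_word :: "(nat \<Rightarrow> complex) \<Rightarrow> nat \<Rightarrow> complex \<Rightarrow> complex" where
  "cf_word w 0 = id"
| "cf_word w (Suc n) = cf_word w n \<circ> cf_map (w n)"

definition cf_point :: "(nat \<Rightarrow> complex) \<Rightarrow> complex" where
  "cf_point w = (THE z. z \<in> (\<Inter>n\<in>{1..}. cf_word w n ` cf_space))"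

definition limit_set :: "complex set \<Rightarrow> complex set" where
  "limit_set I = cf_point ` {w. \<forall>n. w n \<in> I}"

(* Balls are open, so c = 0 always belongs to the set; for r > 0 all its elements are
   at most 1, hence the real supremum is the true one. *)
definition por :: "complex set \<Rightarrow> complex \<Rightarrow> real \<Rightarrow> real" where
  "por G x r = Sup {c. c \<ge> 0 \<and> (\<exists>y. ball y (c * r) \<subseteq> ball x r - G)}"

definition porous :: "complex set \<Rightarrow> bool" where
  "porous G \<longleftrightarrow>
     (\<exists>c r0. 0 < c \<and> c < 1 \<and> r0 > 0 \<and> (\<forall>x\<in>G. \<forall>r. 0 < r \<and> r < r0 \<longrightarrow> por G x r \<ge> c))"

definition squares :: "real \<Rightarrow> complex set set" where
  "squares R = {cbox (a - Complex (R/2) (R/2)) (a + Complex (R/2) (R/2)) |a. True}"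

(* Logarithm of a cardinality, with log 0 = -infinity instead of the library's ln 0 = 0. *)
definition log_count :: "nat \<Rightarrow> ereal" where
  "log_count n = (if n = 0 then -\<infinity> else ereal (ln (real n)))"

definition upper_box_dim :: "complex set \<Rightarrow> ereal" where
  "upper_box_dim I =
     Limsup at_top (\<lambda>R::real. SUP Q\<in>squares R. log_count (card (I \<inter> Q)) / ereal (ln R))"

end

theory Submission
  imports Defs
begin

text \<open>Let \<open>e\<^sub>0 \<in> I\<close> and let \<open>\<xi>\<close> be the fixed point of \<open>z \<mapsto> 1 / (e\<^sub>0 + z)\<close>.
  The limit set contains all points \<open>1 / (e + \<xi>)\<close> with \<open>e \<in> I\<close>. Inversion has small distortion on
  balls that are small compared with their distance from \<open>0\<close>, so porosity of the limit set at small
  scales near \<open>0\<close> becomes porosity of \<open>I\<close> at large scales: every square of large side \<open>L\<close> meets the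
  centre of a ball of radius comparable to \<open>L\<close> that misses \<open>I\<close>; for a square close to the origin one
  works in a smaller square inside it. If such a square is cut into \<open>K\<^sup>2\<close> equal cells with \<open>K\<close> large
  and fixed, one cell lies in that ball. Iterating, a square of side \<open>L K\<^sup>n\<close> contains
  \<open>O((K\<^sup>2 - 1)\<^sup>n)\<close> points of \<open>I\<close>, whence the dimension is at most \<open>log\<^sub>K (K\<^sup>2 - 1) < 2\<close>.\<close>

section \<open>Points of the limit set\<close>

lemma Re_alphabet_ge_1: "e \<in> alphabet \<Longrightarrow> 1 \<le> Re e"
  by (auto simp: alphabet_def)

text \<open>Completing the square: |1/2 - z|^2 = |z|^2 - Re z + 1/4. In this form the disc is easily
  compared with inverses.\<close>

lemma mem_cf_space_iff: "z \<in> cf_space \<longleftrightarrow> (cmod z)\<^sup>2 \<le> Re z"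
proof -
  have eq: "(cmod (1/2 - z))\<^sup>2 = (cmod z)\<^sup>2 - Re z + (1/2)\<^sup>2"
    by (simp only: cmod_power2) (simp add: power2_eq_square algebra_simps)
  have "z \<in> cf_space \<longleftrightarrow> cmod (1/2 - z) \<le> 1/2"
    by (simp add: cf_space_def dist_norm)
  also have "\<dots> \<longleftrightarrow> (cmod (1/2 - z))\<^sup>2 \<le> (1/2)\<^sup>2"
    using abs_le_square_iff[of "cmod (1/2 - z)" "1/2"] by simp
  also have "\<dots> \<longleftrightarrow> (cmod z)\<^sup>2 \<le> Re z"
    unfolding eq by simp
  finally show ?thesis .
qed

lemma Re_cf_space_nonneg: "z \<in> cf_space \<Longrightarrow> 0 \<le> Re z"
  unfolding mem_cf_space_iff by (meson order_trans zero_le_power2)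

lemma Re_inverse_pos:
  fixes u :: complex
  assumes "0 < Re u"
  shows "0 < Re (1 / u)"
proof -
  have "0 < (Re u)\<^sup>2 + (Im u)\<^sup>2"
    using assms by (simp add: add_pos_nonneg)
  then show ?thesis
    using assms by (simp add: Re_divide)
qed

text \<open>After multiplication by |u|^2 the criterion for \<open>1 / u\<close> reads 1 \<le> Re
  u.\<close>

lemma inverse_mem_cf_space:
  assumes "1 \<le> Re u"
  shows "1 / u \<in> cf_space"
proof -
  have p: "0 < (cmod u)\<^sup>2"
    using assms by auto
  have "(cmod (1 / u))\<^sup>2 = 1 / (cmod u)\<^sup>2"
    by (simp add: norm_divide power_divide)
  also have "\<dots> \<le> Re u / (cmod u)\<^sup>2"
    using assms p by (simp add: divide_right_mono)
  also have "\<dots> = Re (1 / u)"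
    by (simp add: Re_divide cmod_power2)
  finally show ?thesis
    by (simp add: mem_cf_space_iff)
qed

section \<open>Fixed points and eventually constant words\<close>

lemma cf_map_fixpoint:
  assumes "1 \<le> Re e"
  obtains \<xi> where "\<xi> \<in> cf_space" "cf_map e \<xi> = \<xi>"
proof -
  have nz: "e + z \<noteq> 0" if "z \<in> cf_space" for z
    using Re_cf_space_nonneg[OF that] assms
    by (metis add_pos_nonneg less_irrefl less_le_trans plus_complex.sel(1) zero_complex.sel(1) zero_less_one)
  have "continuous_on (cball (1/2) (1/2)) (cf_map e)"
    unfolding cf_map_def using nz unfolding cf_space_def by (intro continuous_intros) auto
  moreover have "cf_map e \<in> cball (1/2) (1/2) \<rightarrow> cball (1/2) (1/2)"
    using inverse_mem_cf_space Re_cf_space_nonneg assms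
    by (fastforce simp: cf_map_def cf_space_def)
  \<comment> \<open>Brouwer yields existence alone; that the fixed point attracts iterates is shown
    in \<open>cf_point_eventually_const\<close>.\<close>
  ultimately obtain x where "x \<in> cball (1/2::complex) (1/2)" "cf_map e x = x"
    using brouwer_ball[of "1/2" "1/2" "cf_map e"] by auto
  then show ?thesis
    using that by (auto simp: cf_space_def)
qed

lemma cf_word_eventually_const:
  "cf_word (case_nat e (\<lambda>_. e0)) (Suc n) = cf_map e \<circ> (cf_map e0 ^^ n)"
proof (induction n)
  case (Suc n)
  show ?case
    \<comment> \<open>\<open>cf_word\<close> appends each new letter on the inside, so the power has
      to be unfolded from the right.\<close>
    by (subst cf_word.simps(2)) (simp only: Suc.IH nat.case funpow_Suc_right o_assoc)
qed simp

text \<open>One step gives 1/(e+u) - 1/(e+\<xi>) = (\<xi>-u)/((e+u)(e+\<xi>)). The factor |e+u| is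
  at least 1 and is dropped; the sign of the real part is carried through the induction to guarantee
  this.\<close>

lemma dist_cf_map_iterate:
  assumes e: "1 \<le> Re e" and \<xi>: "\<xi> \<in> cf_space" "cf_map e \<xi> = \<xi>" and z: "0 \<le> Re z"
  shows "0 \<le> Re ((cf_map e ^^ n) z) \<and> dist ((cf_map e ^^ n) z) \<xi> \<le> (1 / cmod (e + \<xi>)) ^ n * dist z \<xi>"
proof (induction n)
  case 0
  then show ?case using z by simp
next
  case (Suc n)
  define u where "u = (cf_map e ^^ n) z"
  have u: "0 \<le> Re u" "dist u \<xi> \<le> (1 / cmod (e + \<xi>)) ^ n * dist z \<xi>"
    using Suc by (auto simp: u_def)
  have 1: "1 \<le> cmod (e + u)" "1 \<le> cmod (e + \<xi>)"
    using complex_Re_le_cmod[of "e + u"] complex_Re_le_cmod[of "e + \<xi>"] e u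
      Re_cf_space_nonneg[OF \<xi>(1)] by auto
  have "cf_map e u - \<xi> = cf_map e u - cf_map e \<xi>"
    using \<xi> by simp
  also have "\<dots> = (\<xi> - u) / ((e + u) * (e + \<xi>))"
    using 1 unfolding cf_map_def by (subst diff_frac_eq) auto
  finally have "dist (cf_map e u) \<xi> = dist u \<xi> / (cmod (e + u) * cmod (e + \<xi>))"
    by (simp add: dist_norm norm_divide norm_mult norm_minus_commute)
  also have "\<dots> \<le> dist u \<xi> / cmod (e + \<xi>)"
    using 1 by (intro divide_left_mono mult_pos_pos) (auto simp: mult_le_cancel_right1)
  also have "\<dots> \<le> ((1 / cmod (e + \<xi>)) ^ n * dist z \<xi>) / cmod (e + \<xi>)"
    using u by (intro divide_right_mono) auto
  finally have "dist (cf_map e u) \<xi> \<le> (1 / cmod (e + \<xi>)) ^ Suc n * dist z \<xi>"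
    by simp
  moreover have "0 \<le> Re (cf_map e u)"
    unfolding cf_map_def using Re_inverse_pos[of "e + u"] e u by simp
  ultimately show ?case
    by (simp add: u_def)
qed

text \<open>Membership holds because \<xi> is fixed by all the inner maps. Uniqueness holds because
  the inner iterates are squeezed onto \<xi>, whatever points of the disc they start from.\<close>

lemma cf_point_eventually_const:
  assumes e: "1 \<le> Re e" and e0: "1 \<le> Re e0" and \<xi>: "\<xi> \<in> cf_space" "cf_map e0 \<xi> = \<xi>"
  shows "cf_point (case_nat e (\<lambda>_. e0)) = cf_map e \<xi>"
  unfolding cf_point_def
proof (rule the_equality)
  have "(cf_map e0 ^^ n) \<xi> = \<xi>" for n
    using \<xi> by (induction n) auto
  then have *: "cf_word (case_nat e (\<lambda>_. e0)) (Suc n) \<xi> = cf_map e \<xi>" for n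
    unfolding cf_word_eventually_const by simp
  show "cf_map e \<xi> \<in> (\<Inter>n\<in>{1..}. cf_word (case_nat e (\<lambda>_. e0)) n ` cf_space)"
  proof
    fix n :: nat assume "n \<in> {1..}"
    then obtain m where "n = Suc m"
      by (cases n) auto
    then show "cf_map e \<xi> \<in> cf_word (case_nat e (\<lambda>_. e0)) n ` cf_space"
      using * \<xi>(1) by (metis imageI)
  qed
next
  fix z assume z: "z \<in> (\<Inter>n\<in>{1..}. cf_word (case_nat e (\<lambda>_. e0)) n ` cf_space)"
  have "\<exists>x\<in>cf_space. z = cf_map e ((cf_map e0 ^^ n) x)" for n
  proof -
    have "z \<in> cf_word (case_nat e (\<lambda>_. e0)) (Suc n) ` cf_space"
      by (rule INT_D[OF z]) simp
    then show ?thesis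
      unfolding cf_word_eventually_const by auto
  qed
  \<comment> \<open>The preimage in the disc depends on n, so the convergence below needs a bound
    uniform in the starting point.\<close>
  then obtain x where x: "\<And>n. x n \<in> cf_space" "\<And>n. z = cf_map e ((cf_map e0 ^^ n) (x n))"
    by metis
  define q where "q = 1 / cmod (e0 + \<xi>)"
  \<comment> \<open>Points of the disc only have Re \<ge> 0; being an inverse makes Re \<xi>
    positive, which gives \<open>q < 1\<close> even if Re e0 = 1.\<close>
  have Re\<xi>: "0 < Re \<xi>"
    using Re_inverse_pos[of "e0 + \<xi>"] \<xi> e0 Re_cf_space_nonneg[OF \<xi>(1)] by (simp add: cf_map_def)
  have "1 < cmod (e0 + \<xi>)"
    using complex_Re_le_cmod[of "e0 + \<xi>"] Re\<xi> e0 by simp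
  then have q: "0 \<le> q" "q < 1"
    unfolding q_def by (simp, subst divide_less_eq_1_pos) linarith+
  have bound: "dist ((cf_map e0 ^^ n) (x n)) \<xi> \<le> q ^ n" for n
  proof -
    \<comment> \<open>The disc has diameter 1, so the initial distance disappears from the
      bound.\<close>
    have "dist (x n) \<xi> \<le> dist (x n) (1/2) + dist \<xi> (1/2)"
      by (rule dist_triangle2)
    also have "\<dots> \<le> 1"
      using x(1)[of n] \<xi>(1) by (simp add: cf_space_def dist_commute)
    finally have "q ^ n * dist (x n) \<xi> \<le> q ^ n"
      using q by (simp add: mult_left_le)
    then show ?thesis
      using dist_cf_map_iterate[OF e0 \<xi> Re_cf_space_nonneg[OF x(1)], of n n] by (simp add: q_def)
  qed
  have "(\<lambda>n. (cf_map e0 ^^ n) (x n)) \<longlonglongrightarrow> \<xi>"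
  proof (rule metric_LIMSEQ_I)
    fix r :: real assume "0 < r"
    have "(\<lambda>n. q ^ n) \<longlonglongrightarrow> 0"
      using q by (simp add: LIMSEQ_realpow_zero)
    then obtain N where "\<And>n. n \<ge> N \<Longrightarrow> q ^ n < r"
      using \<open>0 < r\<close> q by (auto simp: LIMSEQ_def dist_norm)
    then show "\<exists>N. \<forall>n\<ge>N. dist ((cf_map e0 ^^ n) (x n)) \<xi> < r"
      using bound by (meson le_less_trans)
  qed
  moreover have "e + \<xi> \<noteq> 0"
    using e Re\<xi> by (metis add_pos_pos less_irrefl less_le_trans plus_complex.sel(1) zero_complex.sel(1) zero_less_one)
  ultimately have "(\<lambda>n. cf_map e ((cf_map e0 ^^ n) (x n))) \<longlonglongrightarrow> cf_map e \<xi>"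
    unfolding cf_map_def by (intro tendsto_intros) auto
  then show "z = cf_map e \<xi>"
    using x(2) LIMSEQ_unique[of "\<lambda>_. z" z] by (metis (no_types, lifting) LIMSEQ_const_iff ext)
qed

text \<open>Only the first letter varies, before a fixed tail e0, e0, ...; hence one \<xi> serves
  all e.\<close>

lemma limit_set_contains_inverse_translate:
  assumes "I \<subseteq> alphabet" "I \<noteq> {}"
  shows "\<exists>\<xi>. \<forall>e\<in>I. 1 / (e + \<xi>) \<in> limit_set I"
proof -
  obtain e0 where e0: "e0 \<in> I" "1 \<le> Re e0"
    using assms Re_alphabet_ge_1 by blast
  obtain \<xi> where \<xi>: "\<xi> \<in> cf_space" "cf_map e0 \<xi> = \<xi>"
    using cf_map_fixpoint[OF e0(2)] .
  have "1 / (e + \<xi>) \<in> limit_set I" if "e \<in> I" for e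
  proof -
    have "cf_point (case_nat e (\<lambda>_. e0)) = 1 / (e + \<xi>)"
      using cf_point_eventually_const[OF _ e0(2) \<xi>] that assms Re_alphabet_ge_1
      by (auto simp: cf_map_def)
    moreover have "case_nat e (\<lambda>_. e0) n \<in> I" for n
      using that e0 by (cases n) auto
    ultimately show ?thesis
      unfolding limit_set_def by (intro image_eqI[where x = "case_nat e (\<lambda>_. e0)"]) auto
  qed
  then show ?thesis by blast
qed

section \<open>Holes at large scales\<close>

text \<open>The supremum in \<open>por\<close> need not be attained, so a hole is extracted only for
  constants strictly below it.\<close>

lemma por_gt_hole:
  assumes "k < por G x r" "0 \<le> k" "0 < r"
  obtains y where "ball y (k * r) \<subseteq> ball x r - G"
proof -
  define S where "S = {c. c \<ge> 0 \<and> (\<exists>y. ball y (c * r) \<subseteq> ball x r - G)}"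
  \<comment> \<open>A ball of radius 0 is empty; this makes S nonempty, as the supremum argument
    requires.\<close>
  have "0 \<in> S"
    by (simp add: S_def)
  moreover have "k < Sup S"
    using assms(1) by (simp add: S_def por_def)
  ultimately obtain c where "c \<in> S" "k < c"
    using less_cSupD[of S k] by blast
  then obtain y where c: "k < c" "ball y (c * r) \<subseteq> ball x r - G"
    by (auto simp: S_def)
  have "ball y (k * r) \<subseteq> ball y (c * r)"
    using c assms by (intro subset_ball) (simp add: mult_right_mono)
  then show ?thesis using c that by blast
qed

lemma dist_inverse:
  fixes a b :: complex
  assumes "a \<noteq> 0" "b \<noteq> 0"
  shows "dist (1 / a) (1 / b) = dist a b / (cmod a * cmod b)"
proof -
  have "1 / a - 1 / b = (b - a) / (a * b)"
    using assms by (simp add: field_simps)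
  then show ?thesis
    by (simp add: dist_norm norm_divide norm_mult norm_minus_commute)
qed

text \<open>Near w, inversion scales lengths by about |w|^-2, so the radius L / (32 |w|^2) at
  \<open>1 / w\<close> corresponds to about L / 32 at w. The preimage of the hole then contains a
  ball around \<open>1 / y\<close> of radius comparable to k L, and stays close to w.\<close>

lemma hole_inversion:
  fixes w y :: complex and L k :: real
  assumes L: "0 < L" "L / 8 \<le> cmod w" and k: "0 < k" "k \<le> 1"
    and hole: "ball y (k * (L / (32 * (cmod w)\<^sup>2))) \<subseteq> ball (1 / w) (L / (32 * (cmod w)\<^sup>2)) - G"
    and u: "dist (1 / y) u < k * L / 128"
  shows "1 / u \<notin> G" and "dist w u < L / 16"
proof -
  define W where "W = cmod w"
  define r where "r = L / (32 * W\<^sup>2)"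
  have W: "0 < W" "w \<noteq> 0" "L / 8 \<le> W"
    using L by (auto simp: W_def)
  have r: "0 < r" "r * W\<^sup>2 = L / 32"
    using W L by (auto simp: r_def)
  note hole = hole[folded W_def, folded r_def]
  have "y \<in> ball y (k * r)"
    using r k by simp
  then have "y \<in> ball (1 / w) r - G"
    by (rule subsetD[OF hole])
  then have y: "dist (1 / w) y < r"
    by simp
  \<comment> \<open>This is where L \<le> 8 W enters: r is at most a quarter of |1/w|, so all moduli
    in the ball lie between 3/4 and 5/4 of 1/W.\<close>
  have "r \<le> 1 / (4 * W)"
    using W L unfolding r_def by (simp add: field_simps power2_eq_square)
  have x: "cmod (1 / w) = 1 / W"
    by (simp add: W_def norm_divide)
  have near: "3 / (4 * W) \<le> cmod v \<and> cmod v \<le> 5 / (4 * W)" if "dist (1 / w) v < r" for v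
  proof -
    have "\<bar>cmod (1 / w) - cmod v\<bar> \<le> dist (1 / w) v"
      unfolding dist_norm by (rule norm_triangle_ineq3)
    then have "\<bar>1 / W - cmod v\<bar> \<le> (1 / 4) * (1 / W)"
      using that \<open>r \<le> 1 / (4 * W)\<close> x by simp
    moreover have "3 / (4 * W) = (3 / 4) * (1 / W)" "5 / (4 * W) = (5 / 4) * (1 / W)"
      by simp_all
    ultimately show ?thesis by linarith
  qed
  have y_bounds: "3 / (4 * W) \<le> cmod y" "cmod y \<le> 5 / (4 * W)"
    using near[OF y] by auto
  have y0: "0 < cmod y"
    using y_bounds(1) W by (smt (verit) divide_pos_pos)
  have iy: "4 / 5 * W \<le> cmod (1 / y)"
    using y_bounds(2) y0 W by (simp add: norm_divide field_simps)
  have "k * L \<le> L"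
    using k L by (simp add: mult_left_le_one_le)
  have "\<bar>cmod (1 / y) - cmod u\<bar> \<le> dist (1 / y) u"
    unfolding dist_norm by (rule norm_triangle_ineq3)
  then have u_ge: "W / 2 \<le> cmod u"
    using u iy W \<open>k * L \<le> L\<close> by linarith
  then have u0: "u \<noteq> 0" "0 < cmod u"
    using W by auto
  have "dist y (1 / u) = dist (1 / y) u * cmod y / cmod u"
    using dist_inverse[of "1 / y" u] y0 u0 by (simp add: norm_divide)
  \<comment> \<open>The radius k L / 128 is chosen so that the distortion still leaves the factor
    5/8 < 1.\<close>
  also have "\<dots> \<le> (k * L / 128) * (5 / (4 * W)) / (W / 2)"
    using u u_ge y_bounds(2) W u0 k L by (intro frac_le mult_mono) auto
  also have "\<dots> = 5 / 8 * (k * r)"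
    using W by (simp add: r_def field_simps power2_eq_square)
  also have "\<dots> < k * r"
    using k r by simp
  finally have "1 / u \<in> ball y (k * r)"
    by simp
  then have iu: "1 / u \<in> ball (1 / w) r - G"
    by (rule subsetD[OF hole])
  then show "1 / u \<notin> G" by simp
  have "dist (1 / w) (1 / u) < r"
    using iu by simp
  then have iu_ge: "3 / (4 * W) \<le> cmod (1 / u)"
    using near by blast
  then have u_le: "cmod u \<le> 4 / 3 * W"
    using u0 W by (simp add: norm_divide field_simps)
  have "dist w u = dist (1 / w) (1 / u) * (W * cmod u)"
    using dist_inverse[OF W(2) u0(1)] u0 W by (simp add: W_def)
  also have "\<dots> \<le> r * (W * (4 / 3 * W))"
    using \<open>dist (1 / w) (1 / u) < r\<close> u_le W(1) u0(2) r(1)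
    by (intro mult_mono mult_nonneg_nonneg order_refl less_imp_le[OF r(1)] less_imp_le[OF W(1)]) simp_all
  also have "\<dots> = 4 / 3 * (r * W\<^sup>2)"
    by (simp add: power2_eq_square)
  also have "\<dots> < L / 16"
    using r L by simp
  finally show "dist w u < L / 16" .
qed

text \<open>Either a suitable point p of the square is far from all letters and is itself the centre
  of a hole, or a letter lies near p and porosity at the corresponding limit point supplies the
  hole.\<close>

lemma large_scale_holes:
  assumes I: "I \<subseteq> alphabet" and por: "porous (closure (limit_set I))"
  shows "\<exists>c>0. \<exists>L0>0. \<forall>L\<ge>L0. \<forall>a. \<exists>y\<in>cbox a (a + Complex L L). ball y (c * L) \<inter> I = {}"
proof (cases "I = {}")
  case True
  \<comment> \<open>Without letters there is no \<xi> to work with, but every ball is a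
    hole.\<close>
  have "a \<in> cbox a (a + Complex L L)" if "1 \<le> L" for a L
    using that by (simp add: in_cbox_complex_iff)
  then have "\<forall>L\<ge>1. \<forall>a. \<exists>y\<in>cbox a (a + Complex L L). ball y (1 * L) \<inter> I = {}"
    using True by blast
  then show ?thesis
    by (meson zero_less_one)
next
  case False
  define G where "G = closure (limit_set I)"
  obtain \<xi> where \<xi>: "\<And>e. e \<in> I \<Longrightarrow> 1 / (e + \<xi>) \<in> limit_set I"
    using limit_set_contains_inverse_translate[OF I False] by blast
  have G: "1 / (e + \<xi>) \<in> G" if "e \<in> I" for e
    using \<xi>[OF that] closure_subset unfolding G_def by blast
  obtain k r0 where k: "0 < k" "k < 1" and r0: "0 < r0"
    and por: "\<And>x r. x \<in> G \<Longrightarrow> 0 < r \<Longrightarrow> r < r0 \<Longrightarrow> k \<le> por G x r"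
    using por unfolding porous_def G_def[symmetric] by metis
  \<comment> \<open>Here k / 256 = (k / 2) / 128: the 2 pays for the unattained supremum, the 128
    comes from \<open>hole_inversion\<close>. The threshold 3 / r0 brings the radius used at
    \<open>1 / w\<close> below r0.\<close>
  have "\<exists>y\<in>cbox a (a + Complex L L). ball y (k / 256 * L) \<inter> I = {}" if L: "3 / r0 \<le> L" for a L
  proof -
    have L0: "0 < L"
      using L r0 by (smt (verit) divide_pos_pos)
    define b where "b = a + \<xi> + Complex (L / 2) (L / 2)"
    \<comment> \<open>In coordinates shifted by \<xi>, b is the centre of the square. Moving it by L
      / 4 away from the imaginary axis gives |p| \<ge> L / 4, and the disc of radius L / 8 about p
      remains in the square.\<close>
    define p where "p = b + of_real (if 0 \<le> Re b then L / 4 else - L / 4)"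
    have "L / 4 \<le> \<bar>Re p\<bar>"
      using L0 by (auto simp: p_def)
    then have p: "L / 4 \<le> cmod p"
      using abs_Re_le_cmod[of p] by linarith
    have inQ: "z - \<xi> \<in> cbox a (a + Complex L L)" if "dist p z < L / 8" for z
    proof -
      have "\<bar>Re p - Re z\<bar> < L / 8" "\<bar>Im p - Im z\<bar> < L / 8"
        using abs_Re_le_cmod[of "p - z"] abs_Im_le_cmod[of "p - z"] that by (auto simp: dist_norm)
      moreover have "\<bar>Re p - (Re a + Re \<xi> + L / 2)\<bar> = L / 4" "Im p = Im a + Im \<xi> + L / 2"
        using L0 by (auto simp: p_def b_def)
      ultimately have "Re a \<le> Re z - Re \<xi>" "Re z - Re \<xi> \<le> Re a + L"
          "Im a \<le> Im z - Im \<xi>" "Im z - Im \<xi> \<le> Im a + L"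
        using L0 by linarith+
      then show ?thesis
        by (simp add: in_cbox_complex_iff)
    qed
    show ?thesis
    proof (cases "\<exists>e\<in>I. dist p (e + \<xi>) < L / 16")
      case False
      have "p - \<xi> \<in> cbox a (a + Complex L L)"
        using inQ[of p] L0 by simp
      moreover have "ball (p - \<xi>) (k / 256 * L) \<inter> I = {}"
      proof (rule equals0I)
        fix f assume f: "f \<in> ball (p - \<xi>) (k / 256 * L) \<inter> I"
        have "dist p (f + \<xi>) = dist (p - \<xi>) f"
          by (simp add: dist_norm algebra_simps)
        also have "\<dots> < k / 256 * L"
          using f by simp
        also have "\<dots> \<le> L / 16"
          using mult_right_mono[of k 1 L] k L0 by simp
        finally show False
          using False f by blast
      qed
      ultimately show ?thesis by blast
    next
      case True
      then obtain e where e: "e \<in> I" "dist p (e + \<xi>) < L / 16"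
        by blast
      define w where "w = e + \<xi>"
      have w: "dist p w < L / 16"
        using e by (simp add: w_def)
      have "cmod p \<le> cmod w + dist p w"
        unfolding dist_norm by (rule norm_triangle_sub)
      then have wL: "L / 8 \<le> cmod w"
        using p w L0 by linarith
      define r where "r = L / (32 * (cmod w)\<^sup>2)"
      have W: "0 < cmod w"
        using wL L0 by linarith
      have r: "0 < r"
        using L0 W by (simp add: r_def)
      have "r \<le> L / (32 * (L / 8)\<^sup>2)"
        unfolding r_def using wL L0 W by (intro divide_left_mono mult_left_mono power_mono mult_pos_pos) auto
      also have "\<dots> = 2 / L"
        using L0 by (simp add: power2_eq_square)
      also have "\<dots> < 3 / L"
        using L0 by (simp add: divide_strict_right_mono)
      also have "\<dots> \<le> r0"
        using L L0 r0 by (simp add: field_simps)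
      finally have "r < r0" .
      then have "k / 2 < por G (1 / w) r"
        using por[of "1 / w" r] G[OF e(1)] r k by (auto simp: w_def)
      then obtain y where y: "ball y (k / 2 * r) \<subseteq> ball (1 / w) r - G"
        using por_gt_hole k r by (metis half_gt_zero less_imp_le)
      have k2: "0 < k / 2" "k / 2 \<le> 1"
        using k by auto
      note inv = hole_inversion[OF L0 wL k2 y[unfolded r_def]]
      \<comment> \<open>Taking u to be the centre \<open>1 / y\<close> itself; with dist p w < L /
        16 this keeps the centre in the square.\<close>
      have "dist w (1 / y) < L / 16"
        using inv(2)[of "1 / y"] k L0 by simp
      then have "dist p (1 / y) < L / 8"
        using w dist_triangle[of p "1 / y" w] by linarith
      then have "1 / y - \<xi> \<in> cbox a (a + Complex L L)"
        by (rule inQ)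
      moreover have "ball (1 / y - \<xi>) (k / 256 * L) \<inter> I = {}"
      proof (rule equals0I)
        fix f assume f: "f \<in> ball (1 / y - \<xi>) (k / 256 * L) \<inter> I"
        have "dist (1 / y) (f + \<xi>) = dist (1 / y - \<xi>) f"
          by (simp add: dist_norm algebra_simps)
        then have "dist (1 / y) (f + \<xi>) < k / 2 * L / 128"
          using f by simp
        then show False
          using inv(1) G f by blast
      qed
      ultimately show ?thesis by blast
    qed
  qed
  then show ?thesis
    using k r0 by (intro exI[of _ "k / 256"] conjI exI[of _ "3 / r0"]) simp_all
qed

section \<open>Counting\<close>

lemma finite_card_alphabet_square:
  assumes "0 \<le> L"
  shows "finite (alphabet \<inter> cbox a (a + Complex L L))"
    and "real (card (alphabet \<inter> cbox a (a + Complex L L))) \<le> (L + 1)\<^sup>2"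
proof -
  define A where "A = (\<lambda>t::real. {\<lceil>t\<rceil>..\<lfloor>t + L\<rfloor>})"
  define f where "f = (\<lambda>(m, n). Complex (of_int m) (of_int n))"
  have sub: "alphabet \<inter> cbox a (a + Complex L L) \<subseteq> f ` (A (Re a) \<times> A (Im a))"
  proof
    fix z assume z: "z \<in> alphabet \<inter> cbox a (a + Complex L L)"
    then obtain m :: nat and n :: int where mn: "z = of_nat m + of_int n * \<i>"
      by (auto simp: alphabet_def)
    have "(int m, n) \<in> A (Re a) \<times> A (Im a)"
      using z by (auto simp: mn A_def in_cbox_complex_iff ceiling_le_iff le_floor_iff)
    moreover have "z = f (int m, n)"
      by (simp add: mn f_def complex_eq_iff)
    ultimately show "z \<in> f ` (A (Re a) \<times> A (Im a))" by blast
  qed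
  have fin: "finite (A (Re a) \<times> A (Im a))"
    by (simp add: A_def)
  show "finite (alphabet \<inter> cbox a (a + Complex L L))"
    using sub fin by (meson finite_imageI finite_subset)
  have A: "real (card (A t)) \<le> L + 1" for t
    using assms unfolding A_def by simp linarith
  have "card (alphabet \<inter> cbox a (a + Complex L L)) \<le> card (A (Re a) \<times> A (Im a))"
    using sub fin by (meson card_image_le card_mono finite_imageI le_trans)
  then have "real (card (alphabet \<inter> cbox a (a + Complex L L))) \<le> real (card (A (Re a))) * real (card (A (Im a)))"
    by (metis card_cartesian_product of_nat_le_iff of_nat_mult)
  also have "\<dots> \<le> (L + 1) * (L + 1)"
    using A assms by (intro mult_mono) auto
  finally show "real (card (alphabet \<inter> cbox a (a + Complex L L))) \<le> (L + 1)\<^sup>2"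
    by (simp add: power2_eq_square)
qed

section \<open>Subdivision into cells and recursion over scales\<close>

lemma interval_cell:
  fixes t h :: real
  assumes "0 \<le> t" "t \<le> real K * h" "0 < K"
  shows "\<exists>i<K. real i * h \<le> t \<and> t \<le> real i * h + h"
  using assms
\<comment> \<open>Induction avoids the floor of t / h, which at the right end t = K h would be K and
  out of range.\<close>
proof (induction K)
  case (Suc K)
  show ?case
  proof (cases "0 < K \<and> t \<le> real K * h")
    case True
    then show ?thesis
      using Suc by (meson less_Suc_eq)
  next
    case False
    then have "real K * h \<le> t" 
      using Suc.prems by (cases "K = 0") auto
    then show ?thesis
      using Suc.prems by (intro exI[of _ K]) (auto simp: algebra_simps)
  qed
qed simp

lemma square_subset_cells:
  fixes h :: real and K :: nat
  assumes "0 < K" and z: "z \<in> cbox a (a + Complex (K * h) (K * h))"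
  shows "\<exists>i<K. \<exists>j<K. z \<in> cbox (a + Complex (real i * h) (real j * h))
    (a + Complex (real i * h) (real j * h) + Complex h h)"
proof -
  obtain i where "i < K" "real i * h \<le> Re z - Re a" "Re z - Re a \<le> real i * h + h"
    using interval_cell[of "Re z - Re a" K h] assms by (auto simp: in_cbox_complex_iff)
  moreover obtain j where "j < K" "real j * h \<le> Im z - Im a" "Im z - Im a \<le> real j * h + h"
    using interval_cell[of "Im z - Im a" K h] assms by (auto simp: in_cbox_complex_iff)
  ultimately show ?thesis
    by (intro exI[of _ i] conjI exI[of _ j]) (simp_all add: in_cbox_complex_iff)
qed

text \<open>The closed cell containing the centre y has diameter at most 2 h < c K h, so it lies
  inside the hole. The other K^2 - 1 cells cover all of I in the square; shared edges do no harm to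
  an upper bound.\<close>

lemma card_square_step:
  fixes h c :: real and K :: nat
  assumes K: "0 < K" "2 < c * K" and h: "0 < h"
    and hole: "y \<in> cbox a (a + Complex (K * h) (K * h))" "ball y (c * (K * h)) \<inter> I = {}"
    and fin: "\<And>b. finite (I \<inter> cbox b (b + Complex h h))"
    and N: "\<And>b. card (I \<inter> cbox b (b + Complex h h)) \<le> N"
  shows "card (I \<inter> cbox a (a + Complex (K * h) (K * h))) \<le> (K\<^sup>2 - 1) * N"
proof -
  define cell where "cell = (\<lambda>(i, j). cbox (a + Complex (real i * h) (real j * h))
    (a + Complex (real i * h) (real j * h) + Complex h h))"
  have cover: "\<exists>i<K. \<exists>j<K. z \<in> cell (i, j)" if "z \<in> cbox a (a + Complex (K * h) (K * h))" for z
    unfolding cell_def case_prod_conv by (rule square_subset_cells[OF K(1) that])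
  obtain i j where ij: "i < K" "j < K" "y \<in> cell (i, j)"
    using cover[OF hole(1)] by blast
  have "cell (i, j) \<subseteq> ball y (c * (K * h))"
  proof
    fix z assume z: "z \<in> cell (i, j)"
    have "\<bar>Re (y - z)\<bar> \<le> h" "\<bar>Im (y - z)\<bar> \<le> h"
      using z ij(3) by (auto simp: cell_def in_cbox_complex_iff)
    then have "dist y z \<le> 2 * h"
      using cmod_le[of "y - z"] unfolding dist_norm by linarith
    also have "\<dots> < (c * K) * h"
      using K h by (intro mult_strict_right_mono)
    finally show "z \<in> ball y (c * (K * h))"
      by (simp add: mult.assoc)
  qed
  then have empty: "I \<inter> cell (i, j) = {}"
    using hole(2) by blast
  define J where "J = {..<K} \<times> {..<K} - {(i, j)}"
  have cardJ: "finite J" "card J = K\<^sup>2 - 1"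
    using ij by (auto simp: J_def card_cartesian_product power2_eq_square card_Diff_singleton)
  have "I \<inter> cbox a (a + Complex (K * h) (K * h)) \<subseteq> (\<Union>q\<in>J. I \<inter> cell q)"
  proof
    fix z assume z: "z \<in> I \<inter> cbox a (a + Complex (K * h) (K * h))"
    then obtain i' j' where "i' < K" "j' < K" "z \<in> cell (i', j')"
      using cover by blast
    moreover from this have "(i', j') \<noteq> (i, j)"
      using empty z by blast
    ultimately show "z \<in> (\<Union>q\<in>J. I \<inter> cell q)"
      using z unfolding J_def by blast
  qed
  moreover have "finite (\<Union>q\<in>J. I \<inter> cell q)"
    using cardJ(1) fin by (intro finite_UN_I) (auto simp: cell_def split: prod.splits)
  ultimately have "card (I \<inter> cbox a (a + Complex (K * h) (K * h))) \<le> card (\<Union>q\<in>J. I \<inter> cell q)"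
    by (intro card_mono)
  also have "\<dots> \<le> (\<Sum>q\<in>J. card (I \<inter> cell q))"
    by (rule card_UN_le[OF cardJ(1)])
  also have "\<dots> \<le> (\<Sum>q\<in>J. N)"
    by (intro sum_mono) (auto simp: cell_def N split: prod.splits)
  also have "\<dots> = (K\<^sup>2 - 1) * N"
    by (simp add: cardJ)
  finally show ?thesis .
qed

lemma card_square_power_le:
  fixes c L0 :: real and K :: nat
  assumes I: "I \<subseteq> alphabet" and L0: "0 < L0" and K: "0 < K" "2 < c * K"
    and holes: "\<And>L a. L \<ge> L0 \<Longrightarrow> \<exists>y\<in>cbox a (a + Complex L L). ball y (c * L) \<inter> I = {}"
  shows "card (I \<inter> cbox a (a + Complex (L0 * real K ^ n) (L0 * real K ^ n)))
    \<le> nat \<lfloor>(L0 + 1)\<^sup>2\<rfloor> * (K\<^sup>2 - 1) ^ n"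
proof (induction n arbitrary: a)
  case 0
  have "card (I \<inter> cbox a (a + Complex L0 L0)) \<le> card (alphabet \<inter> cbox a (a + Complex L0 L0))"
    using I L0 by (intro card_mono finite_card_alphabet_square) auto
  then have "real (card (I \<inter> cbox a (a + Complex L0 L0))) \<le> (L0 + 1)\<^sup>2"
    using finite_card_alphabet_square(2)[of L0 a] L0 by linarith
  then show ?case
    by (simp add: le_nat_floor)
next
  case (Suc n)
  define h where "h = L0 * real K ^ n"
  have h: "0 < h" and eq: "L0 * real K ^ Suc n = real K * h"
    using L0 K by (auto simp: h_def)
  \<comment> \<open>The side of the large square is still at least L0, so a hole is available at
    every stage.\<close>
  have "1 \<le> real K ^ Suc n"
    using K by (intro one_le_power) simp
  then have "L0 \<le> real K * h"
    unfolding eq[symmetric] using L0 by (simp add: mult_le_cancel_left1)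
  then obtain y where y: "y \<in> cbox a (a + Complex (real K * h) (real K * h))"
      "ball y (c * (real K * h)) \<inter> I = {}"
    using holes by blast
  have "finite (I \<inter> cbox b (b + Complex h h))" for b
    using finite_card_alphabet_square(1)[of h b] h I by (meson finite_subset Int_mono order_refl less_imp_le)
  from card_square_step[OF K h y this Suc.IH[folded h_def]]
  show ?case
    unfolding eq by (simp add: mult.left_commute)
qed

text \<open>The exponent is log_K (K^2 - 1) < 2. General sides R are rounded up to the next L0
  K^n.\<close>

lemma card_square_le_powr:
  assumes I: "I \<subseteq> alphabet" and por: "porous (closure (limit_set I))"
  shows "\<exists>s<2. \<exists>C\<ge>1. \<exists>L0>0. \<forall>R\<ge>L0. \<forall>a. card (I \<inter> cbox a (a + Complex R R)) \<le> C * R powr s"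
proof -
  obtain c L1 :: real where c: "0 < c" and L1: "0 < L1"
    and holes1: "\<And>L a. L \<ge> L1 \<Longrightarrow> \<exists>y\<in>cbox a (a + Complex L L). ball y (c * L) \<inter> I = {}"
    using large_scale_holes[OF I por] by blast
  define L0 where "L0 = max 1 L1"
  have L0: "1 \<le> L0" and holes: "\<And>L a. L \<ge> L0 \<Longrightarrow> \<exists>y\<in>cbox a (a + Complex L L). ball y (c * L) \<inter> I = {}"
    using holes1 by (auto simp: L0_def)
  \<comment> \<open>K > 2 / c lets a cell fit into the hole; K \<ge> 2 makes M \<ge> 1 and the
    powers of K unbounded.\<close>
  define K where "K = nat \<lceil>2 / c\<rceil> + 2"
  have "2 / c < K"
    unfolding K_def by (simp add: of_nat_ceiling le_less_trans) linarith
  then have K: "2 \<le> K" "2 < c * K"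
    using c by (auto simp: K_def field_simps)
  define M where "M = K\<^sup>2 - 1"
  have "2\<^sup>2 \<le> K\<^sup>2"
    using K by (intro power_mono) auto
  then have M: "1 \<le> M" "real M < (real K)\<^sup>2"
    by (auto simp: M_def of_nat_diff)
  define s where "s = log K M"
  have s2: "s < 2"
    unfolding s_def using M K by (subst log_less_iff) (auto simp: powr_numeral)
  have s0: "0 \<le> s"
    unfolding s_def using M K by simp
  have Ks: "real K powr s = M"
    unfolding s_def using M K by simp
  \<comment> \<open>The extra factor M pays for rounding up: M^n = M M^m with n = m + 1.\<close>
  define C where "C = (L0 + 1)\<^sup>2 * M"
  have "1 * 1 \<le> C"
    unfolding C_def using M L0 by (intro mult_mono) (auto simp: power2_eq_square mult_ge1_I)
  moreover have "real (card (I \<inter> cbox a (a + Complex R R))) \<le> C * R powr s" if R: "L0 \<le> R" for R a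
  proof -
    have "\<exists>n. R / L0 < real K ^ n"
      using K by (intro real_arch_pow) simp
    then obtain n where n: "R / L0 < real K ^ n" "\<forall>m<n. \<not> R / L0 < real K ^ m"
      using exists_least_iff[of "\<lambda>n. R / L0 < real K ^ n"] by auto
    \<comment> \<open>R \<ge> L0 excludes n = 0, so minimality can be applied to n - 1.\<close>
    have "n \<noteq> 0"
      using n R L0 by (auto intro!: Nat.gr0I)
    then obtain m where m: "n = Suc m"
      by (cases n) auto
    then have "real K ^ m \<le> R / L0"
      using n(2) by (auto simp: not_less)
    also have "\<dots> \<le> R"
      using R L0 by (simp add: divide_le_eq mult_le_cancel_left1)
    finally have Km: "real K ^ m \<le> R" .
    have RK: "R \<le> L0 * real K ^ n"
      using n(1) L0 by (simp add: field_simps)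
    have "finite (I \<inter> cbox a (a + Complex (L0 * real K ^ n) (L0 * real K ^ n)))"
      using finite_card_alphabet_square(1)[of "L0 * real K ^ n" a] L0 I
      by (meson finite_subset Int_mono order_refl order_trans zero_le_one mult_nonneg_nonneg of_nat_0_le_iff zero_le_power)
    then have "card (I \<inter> cbox a (a + Complex R R))
        \<le> card (I \<inter> cbox a (a + Complex (L0 * real K ^ n) (L0 * real K ^ n)))"
      using RK by (intro card_mono) (auto simp: in_cbox_complex_iff)
    also have "\<dots> \<le> nat \<lfloor>(L0 + 1)\<^sup>2\<rfloor> * M ^ n"
      unfolding M_def using card_square_power_le[OF I _ _ K(2) holes] L0 K by simp
    finally have "real (card (I \<inter> cbox a (a + Complex R R))) \<le> real (nat \<lfloor>(L0 + 1)\<^sup>2\<rfloor>) * real M ^ n"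
      by (metis of_nat_le_iff of_nat_mult of_nat_power)
    also have "\<dots> \<le> (L0 + 1)\<^sup>2 * real M ^ n"
      by (intro mult_right_mono) auto
    also have "\<dots> = C * real M ^ m"
      by (simp add: C_def m)
    also have "real M ^ m = (real K powr s) ^ m"
      by (simp add: Ks)
    also have "\<dots> = (real K ^ m) powr s"
      using K by (simp add: powr_powr powr_realpow[symmetric] mult.commute)
    also have "C * (real K ^ m) powr s \<le> C * R powr s"
      using Km s0 \<open>1 * 1 \<le> C\<close> by (intro mult_left_mono powr_mono2) auto
    finally show ?thesis .
  qed
  ultimately show ?thesis
    using s2 L0 by (intro exI[of _ s] conjI exI[of _ C] exI[of _ L0]) simp_all
qed

section \<open>Passage from counting to the dimension\<close>

theorem theorem4p18:
  fixes I :: "complex set"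
  assumes "I \<subseteq> alphabet"
    and "porous (closure (limit_set I))"
  shows "upper_box_dim I < 2"
proof -
  obtain s C L0 :: real where s: "s < 2" and C: "1 \<le> C" and L0: "0 < L0"
    and count: "\<And>R a. R \<ge> L0 \<Longrightarrow> card (I \<inter> cbox a (a + Complex R R)) \<le> C * R powr s"
    using card_square_le_powr[OF assms] by blast
  \<comment> \<open>The gap t - s absorbs the constant: ln C \<le> (t - s) ln R once R \<ge> exp (ln
    C / (t - s)). Thus the quotient is at most t for all large R, with no limit to compute.\<close>
  define t where "t = (s + 2) / 2"
  have t: "s < t" "t < 2"
    using s by (auto simp: t_def)
  define R0 where "R0 = max (max L0 2) (exp (ln C / (t - s)))"
  have bound: "log_count (card (I \<inter> Q)) / ereal (ln R) \<le> ereal t"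
    if R: "R0 \<le> R" and Q: "Q \<in> squares R" for R Q
  proof (cases "card (I \<inter> Q) = 0")
    case True
    \<comment> \<open>Positivity keeps the quotient at -\<infinity> when the square contains no
      letter.\<close>
    have "0 < ln R"
      using R by (simp add: R0_def)
    then show ?thesis
      using True by (simp add: log_count_def)
  next
    case False
    have R': "L0 \<le> R" "2 \<le> R" "exp (ln C / (t - s)) \<le> R"
      using R by (auto simp: R0_def)
    have lnR: "0 < ln R"
      using R' by simp
    obtain a where a: "Q = cbox (a - Complex (R/2) (R/2)) (a + Complex (R/2) (R/2))"
      using Q by (auto simp: squares_def)
    have "a + Complex (R/2) (R/2) = (a - Complex (R/2) (R/2)) + Complex R R"
      by (simp add: complex_eq_iff)
    then have "real (card (I \<inter> Q)) \<le> C * R powr s"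
      using count[OF R'(1)] a by metis
    then have "ln (real (card (I \<inter> Q))) \<le> ln (C * R powr s)"
      using False C R' by (subst ln_le_cancel_iff) auto
    also have "\<dots> = ln C + s * ln R"
      using C R' by (simp add: ln_mult ln_powr)
    also have "ln C \<le> (t - s) * ln R"
    proof -
      have "ln C / (t - s) \<le> ln R"
        using R' by (subst ln_ge_iff) auto
      then show ?thesis
        using t by (simp add: field_simps)
    qed
    finally have "ln (real (card (I \<inter> Q))) \<le> t * ln R"
      by (simp add: algebra_simps)
    then show ?thesis
      using False lnR by (simp add: log_count_def divide_le_eq)
  qed
  have "upper_box_dim I \<le> ereal t"
    unfolding upper_box_dim_def
  proof (rule Limsup_bounded)
    show "\<forall>\<^sub>F R in at_top. (SUP Q\<in>squares R. log_count (card (I \<inter> Q)) / ereal (ln R)) \<le> ereal t"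
      using eventually_ge_at_top[of R0] by eventually_elim (auto intro!: SUP_least bound)
  qed
  also have "\<dots> < 2"
    using t by simp
  finally show ?thesis .
qed

end
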